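(* Let $n\ge 1$ and $M\ge 2$ be integers, let $X_1,\dots,X_n\in\mathcal X$ be fixed points, and let $Y_i=f(X_i)+W_i$, $i=1,\dots,n$, where $W_1,\dots,W_n$ are independent $N(0,\sigma^2)$ random variables and $f,f_1,\dots,f_M:\mathcal X\to\mathbb R$ are functions bounded in absolute value by a constant $L<\infty$ on $\mathcal X$. Let $a>0$ and define the penalty $$\mathrm{pen}(\lambda)=\frac{2\sigma^2}{n}\left\{1+\frac{2+a}{1+a}\sqrt{L(\lambda)}+\frac{1+a}{a}L(\lambda)\right\}M(\lambda),\qquad \lambda\in\mathbb R^M.$$ Let $\widehat\lambda$ be any minimizer over $\lambda\in\mathbb R^M$ of $\frac1n\sum_{i=1}^n\{Y_i-\mathsf f_\lambda(X_i)\}^2+\mathrm{pen}(\lambda)$, and let $\widetilde f=\mathsf f_{\widehat\lambda}$. Then $$\mathbb E_f\|\widetilde f-f\|_n^2\le(1+a)\inf_{\lambda\in\mathbb R^M}\left[\|\mathsf f_\lambda-f\|_n^2+\frac{\sigma^2}{n}\left\{5+\frac{2+3a}{a}L(\lambda)\right\}M(\lambda)\right]+\frac{\sigma^2}{n}\,\frac{6(1+a)^2}{a(e-1)}.$$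
   Context: $\mathcal X$ is a Borel subset of $\mathbb R^d$. For a function $g:\mathcal X\to\mathbb R$, $\|g\|_n=\{n^{-1}\sum_{i=1}^n g^2(X_i)\}^{1/2}$. For $\lambda=(\lambda_1,\dots,\lambda_M)\in\mathbb R^M$: $\mathsf f_\lambda=\sum_{j=1}^M\lambda_jf_j$; $M(\lambda)$ is the number of nonzero coordinates of $\lambda$; $L(\lambda)=2\log\left(\frac{eM}{M(\lambda)\vee1}\right)$ (a function of $\lambda$, not to be confused with the constant $L$). $\mathbb E_f$ denotes expectation under the model with regression function $f$. $\widehat\lambda$ is a (measurable) function of the data; it need not be unique and the result is for any such minimizer. *)

theory Defs
  imports "HOL-Probability.Probability"
begin

text \<open>
  The sample size \<open>n\<close> and the number \<open>M\<close> of functions in the dictionary are the cardinalities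
  \<open>CARD('n)\<close> and \<open>CARD('m)\<close> of finite index types.  Functions on the domain are represented by
  total functions, whose values outside of the domain are irrelevant.
\<close>

definition emp_norm :: "('n::finite \<Rightarrow> 'x) \<Rightarrow> ('x \<Rightarrow> real) \<Rightarrow> real" where
  "emp_norm x g = sqrt (1 / real CARD('n) * (\<Sum>i\<in>UNIV. (g (x i))\<^sup>2))"

definition lin_comb :: "('m::finite \<Rightarrow> 'x \<Rightarrow> real) \<Rightarrow> real ^ 'm \<Rightarrow> 'x \<Rightarrow> real" where
  "lin_comb F lam = (\<lambda>x. \<Sum>j\<in>UNIV. lam $ j * F j x)"

definition num_nonzero :: "real ^ 'm::finite \<Rightarrow> nat" where
  "num_nonzero lam = card {j. lam $ j \<noteq> 0}"

definition log_factor :: "real ^ 'm::finite \<Rightarrow> real" where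
  "log_factor lam = 2 * ln (exp 1 * real CARD('m) / real (max (num_nonzero lam) 1))"

definition pen :: "nat \<Rightarrow> real \<Rightarrow> real \<Rightarrow> real ^ 'm::finite \<Rightarrow> real" where
  "pen n \<sigma> a lam = 2 * \<sigma>\<^sup>2 / real n *
     (1 + (2 + a) / (1 + a) * sqrt (log_factor lam) + (1 + a) / a * log_factor lam) *
     real (num_nonzero lam)"

definition pls_crit :: "('m::finite \<Rightarrow> 'x \<Rightarrow> real) \<Rightarrow> ('n::finite \<Rightarrow> 'x) \<Rightarrow> real \<Rightarrow> real \<Rightarrow>
    real ^ 'n \<Rightarrow> real ^ 'm \<Rightarrow> real" where
  "pls_crit F x \<sigma> a y lam =
     1 / real CARD('n) * (\<Sum>i\<in>UNIV. (y $ i - lin_comb F lam (x i))\<^sup>2) + pen CARD('n) \<sigma> a lam"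

end

theory Submission
  imports Defs
begin

text \<open>
  Write \<open>h\<close> for the selected fit, \<open>v\<close> for the true mean and \<open>w\<close> for the noise, all as vectors
  indexed by the design points.  Compare the penalised criterion at the minimiser with its value at
  the projection estimator \<open>g + \<Pi>w\<close> of the model supporting a target \<open>g\<close>: this gains
  \<open>\<sigma>\<^sup>2 D / n\<close>, where \<open>D\<close> is the dimension of that model, and exactly this gain turns the
  penalty into the term \<open>5 + (2 + 3a)/a * L(\<lambda>)\<close>, since \<open>4 s \<le> s\<^sup>2 + 4\<close>.  The cross term
  \<open>2 <w, h - v>\<close> is absorbed by Cauchy-Schwarz; the difference \<open>h - v\<close> lies in the sum of the line
  through \<open>v\<close>, which is common to all models, and a space of dimension at most \<open>card J\<close>, where
  \<open>J\<close> is the support of the minimiser.  The line contributes at most \<open>\<sigma>\<^sup>2\<close>; the supremum over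
  \<open>J\<close> of the remaining chi-square variables minus the penalty is bounded with the exponential
  moment of order \<open>3/8\<close> and a union bound over all \<open>J\<close>.
\<close>

subsection \<open>Counting weights\<close>

text \<open>\<open>log_factor\<close> depends on a vector only through its number of nonzero
  coordinates. Making that number the argument lets the same weight be attached to index sets
  \<open>J\<close> and to dimensions.\<close>

definition log_weight :: "nat \<Rightarrow> nat \<Rightarrow> real" where
  "log_weight M k = 2 * ln (exp 1 * real M / real (max k 1))"

lemma log_factor_eq: "log_factor (lam :: real ^ 'm::finite) = log_weight CARD('m) (num_nonzero lam)"
  by (simp add: log_factor_def log_weight_def)

lemma log_weight_ge:
  assumes "k \<le> M" "1 \<le> M" shows "2 \<le> log_weight M k"
proof -
  have "real (max k 1) \<le> real M" "0 < real (max k 1)" using assms by auto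
  then have "exp 1 * 1 \<le> exp 1 * (real M / real (max k 1))"
    by (intro mult_left_mono) auto
  then have "ln (exp 1) \<le> ln (exp 1 * real M / real (max k 1))"
    using \<open>1 \<le> M\<close> by (subst ln_le_cancel_iff) auto
  then show ?thesis by (simp add: log_weight_def)
qed

lemma log_weight_pos:
  assumes "1 \<le> k" "1 \<le> M"
  shows "log_weight M k = 2 * (1 + ln (real M) - ln (real k))"
  using assms by (simp add: log_weight_def ln_mult ln_div max_absorb1)

text \<open>The derivative of t (1 + ln M - ln t) is ln (M / t), nonnegative for t \<le> M. The
  discrete form uses ln (m / k) \<le> m / k - 1 together with a weight of at least 2 at
  \<open>m\<close>. It makes the penalty monotone in the model size.\<close>

lemma mult_log_weight_mono:
  assumes "k \<le> m" "m \<le> M"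
  shows "real k * log_weight M k \<le> real m * log_weight M m"
proof (cases "k = 0")
  case True
  show ?thesis
  proof (cases "M = 0")
    case False
    then have "0 \<le> real m * log_weight M m"
      using log_weight_ge[of m M] assms by (intro mult_nonneg_nonneg) auto
    with True show ?thesis by simp
  qed (use assms in auto)
next
  case False
  then have k: "1 \<le> k" "1 \<le> m" "1 \<le> M" using assms by auto
  have "ln (real m / real k) \<le> real m / real k - 1"
    using k by (intro ln_le_minus_one) auto
  then have "real k * ln (real m / real k) \<le> real k * (real m / real k - 1)"
    using k by (intro mult_left_mono) auto
  also have "\<dots> = real m - real k" using k by (simp add: field_simps)
  finally have 1: "real k * ln (real m) - real k * ln (real k) \<le> real m - real k"
    using k by (simp add: ln_div algebra_simps)
  have 2: "(real m - real k) * 2 \<le> (real m - real k) * log_weight M m"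
    using log_weight_ge[of m M] k assms by (intro mult_left_mono) auto
  show ?thesis using 1 2 k by (simp add: log_weight_pos algebra_simps)
qed

text \<open>Under the root stands k times k \<open>log_weight M k\<close>, a product of two
  nonnegative nondecreasing factors.\<close>

lemma mult_sqrt_log_weight_mono:
  assumes "k \<le> m" "m \<le> M"
  shows "real k * sqrt (log_weight M k) \<le> real m * sqrt (log_weight M m)"
proof -
  have *: "real j * sqrt (log_weight M j) = sqrt (real j * (real j * log_weight M j))" for j
    by (simp add: real_sqrt_mult mult.assoc[symmetric])
  have "real k * (real k * log_weight M k) \<le> real k * (real m * log_weight M m)"
    using mult_log_weight_mono[OF assms] by (intro mult_left_mono) auto
  also have "\<dots> \<le> real m * (real m * log_weight M m)"
    using assms mult_log_weight_mono[of 0 m M] by (intro mult_right_mono) auto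
  finally show ?thesis unfolding * by simp
qed

section \<open>Sharp bounds for binomial coefficients\<close>

text \<open>A weak Stirling bound by induction from (1 + 1/n)^n \<le> e. The leading factor e
  becomes the summand -1 in the exponent of \<open>binomial_le_exp\<close>.\<close>

lemma fact_ge_exp_power:
  assumes "1 \<le> m"
  shows "exp 1 * (real m / exp 1) ^ m \<le> fact m"
  using assms
proof (induction m rule: dec_induct)
  case base show ?case by simp
next
  case (step n)
  have "(1 + 1 / real n) ^ n \<le> exp 1"
    using exp_ge_one_plus_x_over_n_power_n[of n 1] step by simp
  then have "(real n) ^ n * (1 + 1 / real n) ^ n \<le> real n ^ n * exp 1"
    by (intro mult_left_mono) auto
  also have "(real n) ^ n * (1 + 1 / real n) ^ n = real (Suc n) ^ n"
    using step by (simp add: power_mult_distrib[symmetric] field_simps)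
  finally have *: "real (Suc n) ^ n \<le> real n ^ n * exp 1" .
  have "exp 1 * (real (Suc n) / exp 1) ^ Suc n = real (Suc n) * (real (Suc n) ^ n / exp 1 ^ n)"
    by (simp add: power_divide)
  also have "\<dots> \<le> real (Suc n) * (real n ^ n * exp 1 / exp 1 ^ n)"
    using * by (intro mult_left_mono divide_right_mono) auto
  also have "\<dots> = real (Suc n) * (exp 1 * (real n / exp 1) ^ n)"
    by (simp add: power_divide)
  also have "\<dots> \<le> real (Suc n) * fact n" using step by (intro mult_left_mono) auto
  finally show ?case by simp
qed

text \<open>Each factor satisfies M - i \<le> M exp (-i / M), and the i below m sum to m (m - 1) /
  2. The exponential is the gain over the crude bound M^m.\<close>

lemma prod_diff_le_exp:
  assumes "m \<le> M" "1 \<le> M"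
  shows "(\<Prod>i<m. real M - real i) \<le> real M ^ m * exp (- (real m * (real m - 1) / (2 * real M)))"
  using assms(1)
proof (induction m)
  case (Suc m)
  have "real M - real m = real M * (1 + - (real m / real M))" using assms(2) by (simp add: field_simps)
  also have "\<dots> \<le> real M * exp (- (real m / real M))"
    by (intro mult_left_mono exp_ge_add_one_self) auto
  finally have *: "real M - real m \<le> real M * exp (- (real m / real M))" .
  have "(\<Prod>i<Suc m. real M - real i) = (\<Prod>i<m. real M - real i) * (real M - real m)" by simp
  also have "\<dots> \<le> (real M ^ m * exp (- (real m * (real m - 1) / (2 * real M)))) * (real M * exp (- (real m / real M)))"
    using Suc * by (intro mult_mono) auto
  also have "\<dots> = real M ^ Suc m * (exp (- (real m * (real m - 1) / (2 * real M))) * exp (- (real m / real M)))"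
    by simp
  also have "exp (- (real m * (real m - 1) / (2 * real M))) * exp (- (real m / real M))
    = exp (- (real (Suc m) * (real (Suc m) - 1) / (2 * real M)))"
    unfolding exp_add[symmetric] using assms(2) by (simp add: field_simps)
  finally show ?case .
qed simp

lemma binomial_le_exp:
  assumes "1 \<le> m" "m \<le> M"
  shows "real (M choose m) \<le> exp (- 1 + real m * (1 + ln (real M) - ln (real m)) - real m * (real m - 1) / (2 * real M))"
proof -
  have M: "0 < real M" "0 < real m" using assms by auto
  have "real (M choose m) * (exp 1 * (real m / exp 1) ^ m) \<le> real (M choose m) * fact m"
    using fact_ge_exp_power[OF assms(1)] by (intro mult_left_mono) auto
  also have "\<dots> = (\<Prod>i<m. real M - real i)"
    using gbinomial_mult_fact[of m "real M"] by (simp add: binomial_gbinomial mult.commute lessThan_atLeast0)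
  also have "\<dots> \<le> real M ^ m * exp (- (real m * (real m - 1) / (2 * real M)))"
    using assms by (intro prod_diff_le_exp) auto
  finally have "real (M choose m) \<le> real M ^ m * exp (- (real m * (real m - 1) / (2 * real M))) / (exp 1 * (real m / exp 1) ^ m)"
    using M by (subst pos_le_divide_eq) auto
  also have "real M ^ m = exp (real m * ln (real M))" using M by (simp add: exp_of_nat_mult)
  also have "(real m / exp 1) ^ m = exp (real m * (ln (real m) - 1))" using M by (simp add: exp_of_nat_mult exp_diff)
  finally show ?thesis unfolding exp_add[symmetric] exp_diff[symmetric] by (simp add: algebra_simps)
qed

text \<open>With r = m / M, the binomial bound and the weight combine to the exponent -1 - m/2 +
  (m/2) (ln r - r) + r/2. Since ln r - r \<le> -1 and r \<le> 1, it is at most -1/2 - m. Without the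
  correction from \<open>prod_diff_le_exp\<close> only exp (-m/2) would be left when m = M, and 2 /
  sqrt e exceeds 1, so no convergent geometric series would result.\<close>

lemma binomial_weight_le:
  assumes "1 \<le> m" "m \<le> M"
  shows "real (M choose m) * (2 ^ m * exp (- (3 / 4) * (log_weight M m * real m)))
    \<le> exp (- (1 / 2)) * (2 / exp 1) ^ m"
proof -
  have M: "0 < real M" "0 < real m" using assms by auto
  let ?r = "real m / real M"
  have r: "?r \<le> 1" using assms by simp
  have "ln ?r \<le> ?r - 1" using M by (intro ln_le_minus_one) auto
  then have "real m * (ln (real m) - ln (real M) - ?r) \<le> real m * (- 1)"
    using M by (intro mult_left_mono) (auto simp: ln_div)
  with r have *: "- 1 + real m * (1 + ln (real M) - ln (real m)) - real m * (real m - 1) / (2 * real M)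
     + - (3 / 4) * (log_weight M m * real m) \<le> - (1 / 2) + real m * (- 1)"
    using assms M by (simp add: log_weight_pos field_simps)
  have "real (M choose m) * (2 ^ m * exp (- (3 / 4) * (log_weight M m * real m))) \<le>
    exp (- 1 + real m * (1 + ln (real M) - ln (real m)) - real m * (real m - 1) / (2 * real M))
      * (2 ^ m * exp (- (3 / 4) * (log_weight M m * real m)))"
    using binomial_le_exp[OF assms] by (intro mult_right_mono) auto
  also have "\<dots> = 2 ^ m * exp (- 1 + real m * (1 + ln (real M) - ln (real m)) - real m * (real m - 1) / (2 * real M)
     + - (3 / 4) * (log_weight M m * real m))"
    by (simp only: exp_add mult_ac)
  also have "\<dots> \<le> 2 ^ m * exp (- (1 / 2) + real m * (- 1))"
    using * by (intro mult_left_mono) auto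
  also have "\<dots> = exp (- (1 / 2)) * (2 / exp 1) ^ m"
    unfolding exp_add exp_of_nat_mult by (simp add: power_divide exp_minus power_inverse field_simps)
  finally show ?thesis .
qed

section \<open>Numerical constants and the sum over all models\<close>

lemma exp_one_ge: "27 / 10 \<le> exp (1 :: real)"
proof -
  have "(1 + 1 / 8 + (1 / 8)\<^sup>2 / 2 :: real) ^ 8 \<le> exp (1 / 8) ^ 8"
    by (intro power_mono exp_lower_Taylor_quadratic) auto
  also have "\<dots> = exp (1 :: real)" by (simp flip: exp_of_nat_mult)
  finally show ?thesis by (simp add: power2_eq_square power_divide)
qed

text \<open>The final constant: 1 is the contribution of the line through the true mean, 8 / (3 e)
  comes from \<open>le_exp_scaled\<close>, and the last factor is the bound of
  \<open>sum_subsets_weight_le\<close>.\<close>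

lemma risk_constant_le:
  "1 + 8 / (3 * exp 1) * (exp (- (1 / 2)) * (2 / (exp 1 - 2))) \<le> 6 / (exp 1 - 1 :: real)"
proof -
  have "1 + 1 / 2 + (1 / 2)\<^sup>2 / 2 \<le> exp (1 / 2 :: real)"
    by (intro exp_lower_Taylor_quadratic) auto
  then have "exp (- (1 / 2)) \<le> 1 / (13 / 8 :: real)"
    by (auto simp: exp_minus power2_eq_square field_simps)
  then have "8 / (3 * exp 1) * (exp (- (1 / 2)) * (2 / (exp 1 - 2)))
    \<le> 8 / (3 * (27 / 10)) * (1 / (13 / 8) * (2 / (27 / 10 - 2 :: real)))"
    using exp_one_ge by (intro mult_mono divide_left_mono mult_pos_pos) auto
  also have "1 + \<dots> \<le> 6 / (272 / 100 - 1)" by simp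
  also have "\<dots> \<le> 6 / (exp 1 - 1)"
    using e_less_272 exp_one_ge by (intro divide_left_mono mult_pos_pos) auto
  finally show ?thesis by simp
qed

text \<open>The union bound: 2 to the power \<open>card J\<close> dominates the exponential moment
  of a model, the exponential is its share of the penalty. Grouping the sets by size leaves a
  geometric series with ratio 2 / e.\<close>

lemma sum_subsets_weight_le:
  "(\<Sum>J \<in> {J :: 'm::finite set. J \<noteq> {}}. 2 ^ card J * exp (- (3 / 4) * (log_weight CARD('m) (card J) * real (card J))))
    \<le> exp (- (1 / 2)) * (2 / (exp 1 - 2))"
proof -
  let ?M = "CARD('m)"
  let ?g = "\<lambda>k. 2 ^ k * exp (- (3 / 4) * (log_weight ?M k * real k))"
  have e: "2 < exp (1::real)" using exp_lower_Taylor_quadratic[of 1] by simp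
  have "(\<Sum>J \<in> {J :: 'm set. J \<noteq> {}}. ?g (card J))
      = (\<Sum>k\<in>{1..?M}. \<Sum>J \<in> {J \<in> {J :: 'm set. J \<noteq> {}}. card J = k}. ?g (card J))"
    by (rule sum.group[symmetric]) (auto simp: card_gt_0_iff Suc_le_eq intro!: card_mono)
  also have "\<dots> = (\<Sum>k\<in>{1..?M}. real (?M choose k) * ?g k)"
  proof (rule sum.cong[OF refl])
    fix k assume k: "k \<in> {1..?M}"
    then have "{J \<in> {J :: 'm set. J \<noteq> {}}. card J = k} = {J. J \<subseteq> UNIV \<and> card J = k}" by auto
    then have "card {J \<in> {J :: 'm set. J \<noteq> {}}. card J = k} = ?M choose k"
      using n_subsets[of "UNIV :: 'm set" k] by simp
    then show "(\<Sum>J \<in> {J \<in> {J :: 'm set. J \<noteq> {}}. card J = k}. ?g (card J)) = real (?M choose k) * ?g k"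
      by simp
  qed
  also have "\<dots> \<le> (\<Sum>k\<in>{1..?M}. exp (- (1 / 2)) * (2 / exp 1) ^ k)"
    by (intro sum_mono binomial_weight_le) auto
  also have "\<dots> \<le> exp (- (1 / 2)) * (2 / (exp 1 - 2))"
  proof -
    have s: "summable (\<lambda>k. (2 / exp 1 :: real) ^ Suc k)"
      using e by (intro summable_Suc_iff[THEN iffD2] summable_geometric) auto
    have "(\<Sum>k\<in>{1..?M}. (2 / exp 1 :: real) ^ k) = (\<Sum>k<?M. (2 / exp 1) ^ Suc k)"
      by (rule sum.reindex_bij_witness[of _ Suc "\<lambda>k. k - 1"]) auto
    also have "\<dots> \<le> (\<Sum>k. (2 / exp 1) ^ Suc k)"
      by (intro sum_le_suminf s) auto
    also have "\<dots> = 2 / exp 1 * (1 / (1 - 2 / exp 1))"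
      using sums_mult[OF geometric_sums[of "2 / exp 1 :: real"], of "2 / exp 1"] e
      by (intro sums_unique[symmetric]) simp
    also have "\<dots> = 2 / (exp 1 - 2)" using e by (simp add: field_simps)
    finally show ?thesis unfolding sum_distrib_left[symmetric] by (intro mult_left_mono) auto
  qed
  finally show ?thesis .
qed

subsection \<open>Linear algebra and the deterministic oracle inequality\<close>

text \<open>Cauchy-Schwarz in the coordinates of \<open>B\<close>: against a vector of the span,
  only the projection of \<open>w\<close> onto that span counts.\<close>

lemma orthonormal_inner_sq_le:
  fixes B :: "'v::euclidean_space set"
  assumes "finite B" "pairwise orthogonal B" "\<And>u. u \<in> B \<Longrightarrow> norm u = 1" "s \<in> span B"
  shows "(w \<bullet> s)\<^sup>2 \<le> (norm s)\<^sup>2 * (\<Sum>u\<in>B. (w \<bullet> u)\<^sup>2)"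
proof -
  have s: "(\<Sum>u\<in>B. (u \<bullet> s) *\<^sub>R u) = s"
    using orthonormal_basis_expand[OF assms(2,3,4,1)] by (simp add: inner_commute)
  have 1: "y \<bullet> s = (\<Sum>u\<in>B. (u \<bullet> s) * (y \<bullet> u))" for y
    by (subst s[symmetric]) (simp add: inner_sum_right)
  have "(norm s)\<^sup>2 = (\<Sum>u\<in>B. (u \<bullet> s)\<^sup>2)"
    unfolding power2_norm_eq_inner by (subst 1) (simp add: power2_eq_square inner_commute)
  moreover have "(w \<bullet> s)\<^sup>2 \<le> (\<Sum>u\<in>B. (u \<bullet> s)\<^sup>2) * (\<Sum>u\<in>B. (w \<bullet> u)\<^sup>2)"
    unfolding 1[of w] by (rule Cauchy_Schwarz_ineq_sum)
  ultimately show ?thesis by simp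
qed

lemma orthonormal_basis_span_image:
  fixes V :: "'m::finite \<Rightarrow> 'v::euclidean_space"
  obtains B where "finite B" "pairwise orthogonal B" "\<And>u. u \<in> B \<Longrightarrow> norm u = 1"
    "span B = span (V ` J)" "card B = dim (V ` J)" "card B \<le> card J"
proof -
  obtain B where B: "B \<subseteq> span (V ` J)" "pairwise orthogonal B" "\<And>u. u \<in> B \<Longrightarrow> norm u = 1"
    "independent B" "card B = dim (span (V ` J))" "span B = span (V ` J)"
    using orthonormal_basis_subspace[OF subspace_span] by metis
  have "dim (V ` J) \<le> card (V ` J)" by (intro dim_le_card') auto
  also have "\<dots> \<le> card J" by (intro card_image_le) auto
  finally show ?thesis using B by (intro that[of B]) (auto simp: independent_imp_finite)
qed

section \<open>Models as spans of dictionary vectors\<close>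

text \<open>For a unit vector \<open>u\<close> this is the component orthogonal to \<open>u\<close>.
  It is applied with \<open>u\<close> equal to the \<open>sgn\<close> of the true mean; if the mean
  is zero, so is its \<open>sgn\<close>, and nothing is removed.\<close>

definition residual :: "'v::real_inner \<Rightarrow> 'v \<Rightarrow> 'v" where
  "residual u v = v - (u \<bullet> v) *\<^sub>R u"

definition vec_comb :: "('m::finite \<Rightarrow> 'v::real_vector) \<Rightarrow> real ^ 'm \<Rightarrow> 'v" where
  "vec_comb V lam = (\<Sum>j\<in>UNIV. lam $ j *\<^sub>R V j)"

abbreviation supp :: "real ^ 'm::finite \<Rightarrow> 'm set" where
  "supp lam \<equiv> {j. lam $ j \<noteq> 0}"

lemma vec_comb_supp: "vec_comb V lam = (\<Sum>j\<in>supp lam. lam $ j *\<^sub>R V j)"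
  unfolding vec_comb_def by (intro sum.mono_neutral_right) auto

lemma vec_comb_in_span: "vec_comb V lam \<in> span (V ` supp lam)"
  unfolding vec_comb_supp by (intro span_sum span_scale span_base) auto

text \<open>The dictionary vectors may be linearly dependent. A basis extracted from them represents
  the point with as many coefficients as the dimension, which keeps its penalty comparable with a
  gain proportional to the dimension.\<close>

lemma sparse_representation:
  fixes V :: "'m::finite \<Rightarrow> 'v::euclidean_space"
  assumes "s \<in> span (V ` J)"
  obtains mu where "vec_comb V mu = s" "num_nonzero mu \<le> dim (V ` J)"
proof -
  obtain B where B: "B \<subseteq> V ` J" "independent B" "V ` J \<subseteq> span B" "card B = dim (V ` J)"
    using basis_exists[of "V ` J"] by metis
  have fB: "finite B" using B(2) by (rule independent_imp_finite)
  have "s \<in> span B" using assms B(3) span_minimal[OF B(3) subspace_span] by auto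
  then obtain c where c: "s = (\<Sum>v\<in>B. c v *\<^sub>R v)"
    using span_finite[OF fB] by auto
  \<comment> \<open>\<open>V\<close> need not be injective, so one index is picked for each basis
    vector. The index may lie outside \<open>J\<close>, but its vector is the right one.\<close>
  define r where "r v = (SOME j. V j = v)" for v
  have r: "V (r v) = v" if "v \<in> B" for v
    using that B(1) unfolding r_def by (intro someI_ex[where P="\<lambda>j. V j = v"]) auto
  have inj: "inj_on r B" by (metis inj_onI r)
  define mu :: "real ^ 'm" where "mu = (\<chi> j. if j \<in> r ` B then c (V j) else 0)"
  have "vec_comb V mu = (\<Sum>j\<in>r ` B. c (V j) *\<^sub>R V j)"
    unfolding vec_comb_def by (intro sum.mono_neutral_cong_right) (auto simp: mu_def)
  also have "\<dots> = s" using inj r by (simp add: sum.reindex c)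
  finally have 1: "vec_comb V mu = s" .
  have "num_nonzero mu \<le> card (r ` B)"
    unfolding num_nonzero_def by (intro card_mono) (auto simp: mu_def)
  also have "\<dots> \<le> dim (V ` J)" using card_image_le[OF fB, of r] B(4) by simp
  finally show ?thesis using 1 that by blast
qed

text \<open>The error splits orthogonally into a multiple of \<open>sgn v\<close> and a combination
  of the residual vectors on the support, and Cauchy-Schwarz is applied to both. Separating the
  direction of \<open>v\<close> keeps it out of the later union bound.\<close>

lemma inner_diff_sq_le:
  fixes V :: "'m::finite \<Rightarrow> 'v::euclidean_space" and v w :: 'v
  assumes "finite B" "pairwise orthogonal B" "\<And>u. u \<in> B \<Longrightarrow> norm u = 1"
    "span B = span ((\<lambda>j. residual (sgn v) (V j)) ` supp lam)"
  shows "(w \<bullet> (vec_comb V lam - v))\<^sup>2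
    \<le> (norm (vec_comb V lam - v))\<^sup>2 * ((w \<bullet> sgn v)\<^sup>2 + (\<Sum>u\<in>B. (w \<bullet> u)\<^sup>2))"
proof -
  define t where "t = vec_comb (\<lambda>j. residual (sgn v) (V j)) lam"
  \<comment> \<open>The coordinate of the error along \<open>sgn v\<close>. It vanishes for v = 0,
    so multiplying its square by the squared norm of \<open>sgn v\<close> changes nothing in either
    case.\<close>
  define g where "g = (if v = 0 then 0 else (sgn v \<bullet> vec_comb V lam) - norm v)"
  define Q where "Q = (\<Sum>u\<in>B. (w \<bullet> u)\<^sup>2)"
  have t: "t \<in> span B" unfolding t_def assms(4) by (rule vec_comb_in_span)
  have orth: "residual (sgn v) y \<bullet> sgn v = 0" for y
    by (cases "v = 0")
      (simp_all add: residual_def inner_diff_left inner_commute[of y] dot_square_norm norm_sgn)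
  have t0: "t \<bullet> sgn v = 0"
    unfolding t_def vec_comb_def inner_sum_left by (simp add: orth)
  have "t = vec_comb V lam - (sgn v \<bullet> vec_comb V lam) *\<^sub>R sgn v"
    unfolding t_def vec_comb_def residual_def
    by (simp add: scaleR_diff_right sum_subtractf inner_sum_right scaleR_sum_left)
  moreover have "v = norm v *\<^sub>R sgn v" by (cases "v = 0") (simp_all add: sgn_div_norm)
  ultimately have z: "vec_comb V lam - v = t + g *\<^sub>R sgn v"
    unfolding g_def by (cases "v = 0") (auto simp: algebra_simps)
  have "(norm (t + g *\<^sub>R sgn v))\<^sup>2 = (norm t)\<^sup>2 + g\<^sup>2 * (norm (sgn v))\<^sup>2"
    unfolding power2_norm_eq_inner using t0
    by (simp add: inner_add_left inner_add_right inner_commute power2_eq_square)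
  also have "g\<^sup>2 * (norm (sgn v))\<^sup>2 = g\<^sup>2" by (simp add: norm_sgn g_def)
  finally have nz: "(norm (vec_comb V lam - v))\<^sup>2 = (norm t)\<^sup>2 + g\<^sup>2" unfolding z .
  have wt: "(w \<bullet> t)\<^sup>2 \<le> (norm t)\<^sup>2 * Q"
    unfolding Q_def using assms t by (intro orthonormal_inner_sq_le) auto
  have Q: "0 \<le> Q" unfolding Q_def by (intro sum_nonneg) auto
  have "\<bar>w \<bullet> t\<bar> \<le> norm t * sqrt Q"
    using real_sqrt_le_mono[OF wt] by (simp add: real_sqrt_mult)
  then have "\<bar>w \<bullet> t + g * (w \<bullet> sgn v)\<bar> \<le> norm t * sqrt Q + \<bar>g\<bar> * \<bar>w \<bullet> sgn v\<bar>"
    using abs_triangle_ineq[of "w \<bullet> t" "g * (w \<bullet> sgn v)"] by (simp add: abs_mult)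
  then have "(w \<bullet> t + g * (w \<bullet> sgn v))\<^sup>2 \<le> (norm t * sqrt Q + \<bar>g\<bar> * \<bar>w \<bullet> sgn v\<bar>)\<^sup>2"
    using power_mono[of "\<bar>w \<bullet> t + g * (w \<bullet> sgn v)\<bar>" _ 2] by simp
  also have "\<dots> \<le> ((norm t)\<^sup>2 + \<bar>g\<bar>\<^sup>2) * ((sqrt Q)\<^sup>2 + \<bar>w \<bullet> sgn v\<bar>\<^sup>2)"
  proof -
    have "(p * q + x * y)\<^sup>2 \<le> (p\<^sup>2 + x\<^sup>2) * (q\<^sup>2 + y\<^sup>2)" for p q x y :: real
      using zero_le_power2[of "p * y - x * q"] by (simp add: power2_eq_square algebra_simps)
    then show ?thesis .
  qed
  finally show ?thesis unfolding nz using Q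
    by (simp add: z inner_add_right Q_def[symmetric] add.commute)
qed

section \<open>Bounds on the penalty\<close>

lemma num_nonzero_le: "num_nonzero (lam :: real ^ 'm::finite) \<le> CARD('m)"
  unfolding num_nonzero_def by (intro card_mono) auto

text \<open>Monotonicity first moves the penalty to size \<open>D\<close>, where the square root is
  traded for half a weight plus a constant; this yields 6 D plus a weight term. One \<open>D\<close>
  is kept aside, to cancel later against the mean gain of the projection estimator, and the rest is
  moved on to the size of \<open>lam\<close>. The coefficient of the weight is 2 (1 + a) / a + 1 =
  (2 + 3 a) / a.\<close>

lemma pen_le:
  fixes mu lam :: "real ^ 'm::finite"
  assumes "num_nonzero mu \<le> D" "D \<le> num_nonzero lam" "a > 0" "n > 0"
  shows "real n * pen n \<sigma> a mu
    \<le> \<sigma>\<^sup>2 * (real D + (5 + (2 + 3 * a) / a * log_factor lam) * real (num_nonzero lam))"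
proof -
  let ?M = "CARD('m)" and ?k = "num_nonzero mu" and ?m = "num_nonzero lam"
  let ?l = "log_weight ?M"
  let ?c = "(1 + a) / a" and ?d = "(2 + a) / (1 + a)"
  note D = le_trans[OF assms(2) num_nonzero_le]
  have c: "(2 + 3 * a) / a = 2 * ?c + 1" using assms by (simp add: field_simps)
  have d: "0 \<le> ?d" "?d \<le> 2" using assms by (auto simp: field_simps)
  have l: "0 \<le> ?l D" using log_weight_ge[OF D] by simp
  have "0 \<le> (sqrt (?l D) - 2)\<^sup>2" by simp
  then have s: "4 * sqrt (?l D) \<le> ?l D + 4" using l by (simp add: power2_diff)
  have "?d * sqrt (?l D) \<le> 2 * sqrt (?l D)" using d l by (intro mult_right_mono) auto
  with s have "2 * (?d * sqrt (?l D)) \<le> ?l D + 4" by linarith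
  then have s': "real D * (2 * (?d * sqrt (?l D))) \<le> real D * (?l D + 4)" by (intro mult_left_mono) auto
  have "2 * (1 + ?d * sqrt (?l ?k) + ?c * ?l ?k) * real ?k
    = 2 * real ?k + 2 * ?d * (real ?k * sqrt (?l ?k)) + 2 * ?c * (real ?k * ?l ?k)"
    by (simp add: algebra_simps)
  also have "\<dots> \<le> 2 * real D + 2 * ?d * (real D * sqrt (?l D)) + 2 * ?c * (real D * ?l D)"
    using assms d D
    by (intro add_mono mult_left_mono mult_sqrt_log_weight_mono mult_log_weight_mono) auto
  also have "\<dots> \<le> real D + (5 * real D + (2 * ?c + 1) * (real D * ?l D))"
    using s' by (simp add: algebra_simps)
  also have "\<dots> \<le> real D + (5 * real ?m + (2 * ?c + 1) * (real ?m * ?l ?m))"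
    using assms by (intro add_mono mult_left_mono mult_log_weight_mono num_nonzero_le) auto
  also have "\<dots> = real D + (5 + (2 + 3 * a) / a * ?l ?m) * real ?m"
    unfolding c by (simp add: algebra_simps)
  finally have "\<sigma>\<^sup>2 * (2 * (1 + ?d * sqrt (?l ?k) + ?c * ?l ?k) * real ?k) \<le> \<sigma>\<^sup>2 * \<dots>"
    by (intro mult_left_mono) auto
  moreover have "real n * pen n \<sigma> a mu
    = \<sigma>\<^sup>2 * (2 * (1 + ?d * sqrt (?l ?k) + ?c * ?l ?k) * real ?k)"
    using assms(4) by (simp add: pen_def log_factor_eq)
  ultimately show ?thesis unfolding log_factor_eq by simp
qed

text \<open>Only the last summand of the penalty is kept. Its factor (1 + a) / a is the one with
  which the chi-square term enters the oracle inequality.\<close>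

lemma pen_ge:
  fixes lam :: "real ^ 'm::finite"
  assumes "a > 0" "n > 0"
  shows "(1 + a) / a * (2 * \<sigma>\<^sup>2 * (log_factor lam * real (num_nonzero lam))) \<le> real n * pen n \<sigma> a lam"
proof -
  have "0 \<le> log_factor lam"
    unfolding log_factor_eq using log_weight_ge[OF num_nonzero_le, of lam] by simp
  then have "0 \<le> 2 * \<sigma>\<^sup>2 * (1 + (2 + a) / (1 + a) * sqrt (log_factor lam)) * real (num_nonzero lam)"
    using assms by (intro mult_nonneg_nonneg add_nonneg_nonneg) auto
  moreover have "real n * pen n \<sigma> a lam = 2 * \<sigma>\<^sup>2 *
    (1 + (2 + a) / (1 + a) * sqrt (log_factor lam) + (1 + a) / a * log_factor lam) * real (num_nonzero lam)"
    using assms by (simp add: pen_def)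
  ultimately show ?thesis by (simp only: distrib_left distrib_right mult_ac add_increasing)
qed

text \<open>The tangent of exp at 1, rescaled. Positivity of the right-hand side is what allows a
  maximum over models to be replaced by a sum.\<close>

lemma le_exp_scaled: "x \<le> 8 / (3 * exp 1) * exp (3 / 8 * x :: real)"
proof -
  have "3 / 8 * x \<le> exp (3 / 8 * x - 1)" using exp_ge_add_one_self[of "3 / 8 * x - 1"] by simp
  then have "3 / 8 * x \<le> exp (3 / 8 * x) / exp 1" by (simp only: exp_diff)
  then show ?thesis by (simp add: field_simps)
qed

text \<open>Everything random on the right is expressed through inner products of \<open>w\<close>
  with fixed vectors, so its mean can be computed although the minimiser depends on the noise. The
  term linear in \<open>w\<close> has a fixed direction \<open>q\<close> and will have mean
  zero.\<close>

lemma oracle_inequality_pointwise: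
  fixes V :: "'m::finite \<Rightarrow> 'v::euclidean_space" and lam lh :: "real ^ 'm" and v w :: 'v
  assumes "a > 0" "\<sigma> > 0" "n > 0"
    and min: "\<And>mu. (norm (v + w - vec_comb V lh))\<^sup>2 + real n * pen n \<sigma> a lh
      \<le> (norm (v + w - vec_comb V mu))\<^sup>2 + real n * pen n \<sigma> a mu"
    and B: "finite B" "pairwise orthogonal B" "\<And>u. u \<in> B \<Longrightarrow> norm u = 1"
      "span B = span (V ` supp lam)"
    and BJ: "\<And>J. finite (BJ J)" "\<And>J. pairwise orthogonal (BJ J)"
      "\<And>J u. u \<in> BJ J \<Longrightarrow> norm u = 1"
      "\<And>J. span (BJ J) = span ((\<lambda>j. residual (sgn v) (V j)) ` J)"
    and q: "q = v - vec_comb V lam - (\<Sum>u\<in>B. ((v - vec_comb V lam) \<bullet> u) *\<^sub>R u)"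
  shows "(norm (vec_comb V lh - v))\<^sup>2 \<le> (1 + a) *
    ((norm (vec_comb V lam - v))\<^sup>2 + 2 * (w \<bullet> q) - (\<Sum>u\<in>B. (w \<bullet> u)\<^sup>2)
     + \<sigma>\<^sup>2 * (real (card B) + (5 + (2 + 3 * a) / a * log_factor lam) * real (num_nonzero lam))
     + (1 + a) / a * ((w \<bullet> sgn v)\<^sup>2 + \<sigma>\<^sup>2 * (8 / (3 * exp 1) *
         (\<Sum>J\<in>{J. J \<noteq> {}}. exp (3 / 8 * (\<Sum>u\<in>BJ J. ((w /\<^sub>R \<sigma>) \<bullet> u)\<^sup>2) -
            3 / 4 * (log_weight CARD('m) (card J) * real (card J)))))))"
proof -
  let ?h = "vec_comb V lh" and ?g = "vec_comb V lam"
  \<comment> \<open>The orthogonal projection of the noise onto the model of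
    \<open>lam\<close>.\<close>
  define p where "p = (\<Sum>u\<in>B. (w \<bullet> u) *\<^sub>R u)"
  define c where "c = (1 + a) / a"
  define Q where "Q = (\<Sum>u\<in>BJ (supp lh). (w \<bullet> u)\<^sup>2)"
  \<comment> \<open>The coefficient 3/4 is 3/8 times the factor 2 in the penalty.\<close>
  define E where "E J = exp (3 / 8 * (\<Sum>u\<in>BJ J. ((w /\<^sub>R \<sigma>) \<bullet> u)\<^sup>2) -
            3 / 4 * (log_weight CARD('m) (card J) * real (card J)))" for J
  have c: "0 < c" using assms by (simp add: c_def)
  have pB: "p \<in> span B" unfolding p_def by (intro span_sum span_scale span_base)
  have pu: "p \<bullet> u = w \<bullet> u" if "u \<in> B" for u
  proof -
    have "p \<bullet> u = (\<Sum>x\<in>B. (w \<bullet> x) * (if x = u then 1 else 0))"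
      unfolding p_def inner_sum_left
    proof (rule sum.cong)
      fix x assume x: "x \<in> B"
      show "((w \<bullet> x) *\<^sub>R x) \<bullet> u = (w \<bullet> x) * (if x = u then 1 else 0)"
        using B(2) B(3)[OF x] x that
        by (auto simp: pairwise_def orthogonal_def dot_square_norm)
    qed simp
    also have "\<dots> = w \<bullet> u" using that B(1) by (simp add: if_distrib cong: if_cong)
    finally show ?thesis .
  qed
  have pp: "p \<bullet> p = (\<Sum>u\<in>B. (w \<bullet> u)\<^sup>2)"
    by (subst (2) p_def) (simp add: inner_sum_right pu power2_eq_square)
  have wp: "w \<bullet> p = p \<bullet> p"
    unfolding pp by (simp add: p_def inner_sum_right power2_eq_square)
  \<comment> \<open>The projection is self-adjoint, so it can be moved from the noise to the
    deterministic vector.\<close>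
  have "z \<bullet> w - z \<bullet> p = w \<bullet> (z - (\<Sum>u\<in>B. (z \<bullet> u) *\<^sub>R u))" for z
    unfolding p_def by (simp add: inner_diff_right inner_sum_right inner_commute mult.commute)
  from this[of "v - ?g"] have wq: "(v - ?g) \<bullet> w - (v - ?g) \<bullet> p = w \<bullet> q"
    unfolding q .
  have "?g \<in> span B" unfolding B(4) by (rule vec_comb_in_span)
  then have "?g + p \<in> span (V ` supp lam)" using pB B(4) by (auto intro: span_add)
  \<comment> \<open>The competitor in the minimality hypothesis may depend on the noise, since the
    argument is for one fixed \<open>w\<close>.\<close>
  then obtain mu where mu: "vec_comb V mu = ?g + p" "num_nonzero mu \<le> dim (V ` supp lam)"
    by (rule sparse_representation)
  have ind: "independent B"
    using B(2) B(3)[of 0] by (intro pairwise_orthogonal_independent) auto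
  have D: "dim (V ` supp lam) = card B"
    using B(4) dim_eq_card_independent[OF ind] by (metis dim_span)
  have "dim (V ` supp lam) \<le> card (V ` supp lam)" by (intro dim_le_card') auto
  also have "\<dots> \<le> num_nonzero lam" unfolding num_nonzero_def by (intro card_image_le) auto
  finally have "card B \<le> num_nonzero lam" using D by simp
  then have pen: "real n * pen n \<sigma> a mu
    \<le> \<sigma>\<^sup>2 * (real (card B) + (5 + (2 + 3 * a) / a * log_factor lam) * real (num_nonzero lam))"
    using mu D assms by (intro pen_le) auto
  have lhs: "(norm (v + w - ?h))\<^sup>2 = (norm (?h - v))\<^sup>2 - 2 * (w \<bullet> (?h - v)) + w \<bullet> w"
    unfolding power2_norm_eq_inner by (simp add: algebra_simps inner_commute)
  have expand: "(norm (z + (w - p)))\<^sup>2 = z \<bullet> z + 2 * (z \<bullet> w - z \<bullet> p) + (w \<bullet> w - 2 * (w \<bullet> p) + p \<bullet> p)" for z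
    unfolding power2_norm_eq_inner by (simp add: algebra_simps inner_commute)
  have shift: "v + w - vec_comb V mu = (v - ?g) + (w - p)" unfolding mu by simp
  have "(norm (v + w - vec_comb V mu))\<^sup>2 = (v - ?g) \<bullet> (v - ?g)
     + 2 * ((v - ?g) \<bullet> w - (v - ?g) \<bullet> p) + (w \<bullet> w - 2 * (w \<bullet> p) + p \<bullet> p)"
    unfolding shift by (rule expand)
  also have "\<dots> = (norm (?g - v))\<^sup>2 + 2 * (w \<bullet> q) + w \<bullet> w - (\<Sum>u\<in>B. (w \<bullet> u)\<^sup>2)"
    unfolding wq wp pp[symmetric] power2_norm_eq_inner by (simp add: algebra_simps inner_commute)
  finally have rhs: "(norm (v + w - vec_comb V mu))\<^sup>2 = \<dots>" .
  have cs: "(w \<bullet> (?h - v))\<^sup>2 \<le> (norm (?h - v))\<^sup>2 * ((w \<bullet> sgn v)\<^sup>2 + Q)"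
    unfolding Q_def by (intro inner_diff_sq_le BJ)
  \<comment> \<open>The weight \<open>c\<close> matches \<open>pen_ge\<close> and leaves the
    fraction 1 - 1/c = 1 / (1 + a) of the squared error on the left.\<close>
  have amgm: "2 * (w \<bullet> (?h - v)) \<le> 1 / c * (norm (?h - v))\<^sup>2 + c * ((w \<bullet> sgn v)\<^sup>2 + Q)"
  proof -
    let ?S = "(w \<bullet> sgn v)\<^sup>2 + Q"
    have S: "0 \<le> ?S" unfolding Q_def by (intro add_nonneg_nonneg sum_nonneg) auto
    have "w \<bullet> (?h - v) \<le> norm (?h - v) * sqrt ?S"
      using real_sqrt_le_mono[OF cs] by (simp add: real_sqrt_mult)
    moreover have "0 \<le> (norm (?h - v) / sqrt c - sqrt c * sqrt ?S)\<^sup>2" by simp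
    then have "2 * (norm (?h - v) * sqrt ?S) \<le> 1 / c * (norm (?h - v))\<^sup>2 + c * ?S"
      using c S by (simp add: power2_diff power_divide power_mult_distrib)
    ultimately show ?thesis by linarith
  qed
  have dev: "Q - 2 * \<sigma>\<^sup>2 * (log_factor lh * real (num_nonzero lh))
    \<le> \<sigma>\<^sup>2 * (8 / (3 * exp 1) * (\<Sum>J\<in>{J. J \<noteq> {}}. E J))"
  \<comment> \<open>The sum runs over nonempty sets only. For empty support the basis consists of
    unit vectors in the zero space, hence is empty, and \<open>Q\<close> is zero.\<close>
  proof (cases "supp lh = {}")
    case True
    then have "span (BJ (supp lh)) = {0}" using BJ(4)[of "{}"] by simp
    then have "BJ (supp lh) \<subseteq> {0}" using span_superset by blast
    then have "BJ (supp lh) = {}" using BJ(3)[of 0 "supp lh"] by auto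
    then have "Q = 0" "num_nonzero lh = 0" using True by (auto simp: Q_def num_nonzero_def)
    moreover have "0 \<le> (\<Sum>J\<in>{J. J \<noteq> {}}. E J)" by (intro sum_nonneg) (simp add: E_def)
    ultimately show ?thesis by simp
  next
    case False
    have "Q / \<sigma>\<^sup>2 - 2 * (log_factor lh * real (num_nonzero lh)) \<le> 8 / (3 * exp 1) *
      exp (3 / 8 * (Q / \<sigma>\<^sup>2 - 2 * (log_factor lh * real (num_nonzero lh))))"
      by (rule le_exp_scaled)
    also have "exp (3 / 8 * (Q / \<sigma>\<^sup>2 - 2 * (log_factor lh * real (num_nonzero lh)))) = E (supp lh)"
      unfolding E_def Q_def log_factor_eq num_nonzero_def
      by (simp add: power_divide power_mult_distrib sum_divide_distrib field_simps)
    also have "E (supp lh) \<le> (\<Sum>J\<in>{J. J \<noteq> {}}. E J)"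
      using False by (intro member_le_sum) (auto simp: E_def)
    finally have "\<sigma>\<^sup>2 * (Q / \<sigma>\<^sup>2 - 2 * (log_factor lh * real (num_nonzero lh)))
      \<le> \<sigma>\<^sup>2 * (8 / (3 * exp 1) * (\<Sum>J\<in>{J. J \<noteq> {}}. E J))"
      by (intro mult_left_mono) (auto simp: field_simps)
    then show ?thesis using assms(2) by (simp add: right_diff_distrib)
  qed
  have "c * (Q - 2 * \<sigma>\<^sup>2 * (log_factor lh * real (num_nonzero lh)))
    \<le> c * (\<sigma>\<^sup>2 * (8 / (3 * exp 1) * (\<Sum>J\<in>{J. J \<noteq> {}}. E J)))"
    using dev c by (intro mult_left_mono) auto
  then have dev': "c * ((w \<bullet> sgn v)\<^sup>2 + Q) - real n * pen n \<sigma> a lh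
    \<le> c * ((w \<bullet> sgn v)\<^sup>2 + \<sigma>\<^sup>2 * (8 / (3 * exp 1) * (\<Sum>J\<in>{J. J \<noteq> {}}. E J)))"
    using pen_ge[OF assms(1,3), of \<sigma> lh] unfolding c_def[symmetric]
    by (simp only: right_diff_distrib distrib_left)
  define R where "R = (norm (?g - v))\<^sup>2 + 2 * (w \<bullet> q) - (\<Sum>u\<in>B. (w \<bullet> u)\<^sup>2)
     + \<sigma>\<^sup>2 * (real (card B) + (5 + (2 + 3 * a) / a * log_factor lam) * real (num_nonzero lam))
     + c * ((w \<bullet> sgn v)\<^sup>2 + \<sigma>\<^sup>2 * (8 / (3 * exp 1) * (\<Sum>J\<in>{J. J \<noteq> {}}. E J)))"
  have "(norm (?h - v))\<^sup>2 - 1 / c * (norm (?h - v))\<^sup>2 \<le> R"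
    using min[of mu] lhs rhs amgm dev' pen unfolding R_def by linarith
  then have "(1 + a) * ((norm (?h - v))\<^sup>2 - 1 / c * (norm (?h - v))\<^sup>2) \<le> (1 + a) * R"
    using assms by (intro mult_left_mono) auto
  also have "(1 + a) * ((norm (?h - v))\<^sup>2 - 1 / c * (norm (?h - v))\<^sup>2) = (norm (?h - v))\<^sup>2"
    using assms by (simp add: c_def field_simps)
  finally show ?thesis unfolding R_def E_def c_def .
qed

subsection \<open>Gaussian noise\<close>

text \<open>Completing the square turns the integrand into a constant times another normal density,
  with variance \<tau>^2 / k for k = 1 - 2 l \<tau>^2.\<close>

lemma nn_integral_normal_exp_quadratic:
  fixes \<alpha> l \<tau> :: real
  assumes "\<tau> > 0" "2 * l * \<tau>\<^sup>2 < 1"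
  shows "(\<integral>\<^sup>+x. ennreal (normal_density 0 \<tau> x) * ennreal (exp (\<alpha> * x + l * x\<^sup>2)) \<partial>lborel)
    = ennreal (1 / sqrt (1 - 2 * l * \<tau>\<^sup>2) * exp (\<alpha>\<^sup>2 * \<tau>\<^sup>2 / (2 * (1 - 2 * l * \<tau>\<^sup>2))))"
proof -
  define k where "k = 1 - 2 * l * \<tau>\<^sup>2"
  have k: "k > 0" using assms by (simp add: k_def)
  define C where "C = 1 / sqrt k * exp (\<alpha>\<^sup>2 * \<tau>\<^sup>2 / (2 * k))"
  have l: "l = (1 - k) / (2 * \<tau>\<^sup>2)" using assms by (simp add: k_def field_simps)
  have eq: "normal_density 0 \<tau> x * exp (\<alpha> * x + l * x\<^sup>2)
    = C * normal_density (\<alpha> * \<tau>\<^sup>2 / k) (\<tau> / sqrt k) x" for x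
  proof -
    have "- (x\<^sup>2 / (2 * \<tau>\<^sup>2)) + (\<alpha> * x + l * x\<^sup>2)
      = \<alpha>\<^sup>2 * \<tau>\<^sup>2 / (2 * k) + - ((x - \<alpha> * \<tau>\<^sup>2 / k)\<^sup>2 / (2 * (\<tau> / sqrt k)\<^sup>2))"
      unfolding l using k assms(1) by (simp add: power2_eq_square field_simps)
    then have "exp (- (x\<^sup>2 / (2 * \<tau>\<^sup>2))) * exp (\<alpha> * x + l * x\<^sup>2)
      = exp (\<alpha>\<^sup>2 * \<tau>\<^sup>2 / (2 * k)) * exp (- ((x - \<alpha> * \<tau>\<^sup>2 / k)\<^sup>2 / (2 * (\<tau> / sqrt k)\<^sup>2)))"
      unfolding exp_add[symmetric] by simp
    moreover have "1 / sqrt (2 * pi * \<tau>\<^sup>2) = 1 / sqrt k * (1 / sqrt (2 * pi * (\<tau> / sqrt k)\<^sup>2))"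
      using k assms(1) by (simp add: real_sqrt_mult real_sqrt_divide power_divide)
    ultimately show ?thesis
      unfolding normal_density_def C_def by simp
  qed
  have "(\<integral>\<^sup>+x. ennreal (normal_density 0 \<tau> x) * ennreal (exp (\<alpha> * x + l * x\<^sup>2)) \<partial>lborel)
    = (\<integral>\<^sup>+x. ennreal C * ennreal (normal_density (\<alpha> * \<tau>\<^sup>2 / k) (\<tau> / sqrt k) x) \<partial>lborel)"
    unfolding ennreal_mult'[symmetric, OF normal_density_nonneg] eq
    using k by (intro nn_integral_cong ennreal_mult) (auto simp: C_def)
  also have "\<dots> = ennreal C * ennreal 1"
    using k assms(1)
    by (subst nn_integral_cmult) (auto simp: nn_integral_eq_integral)
  finally show ?thesis unfolding C_def k_def by simp
qed

text \<open>The square in the exponent is linearised by an auxiliary Gaussian variable: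
  \<open>exp (l * s\<^sup>2)\<close> is the mean of \<open>exp (sqrt (2 * l) * g * s)\<close> over a standard normal \<open>g\<close>.\<close>

lemma (in prob_space) nn_integral_gaussian_exp_projection:
  fixes X :: "'a \<Rightarrow> 'v::euclidean_space"
  assumes X [measurable]: "X \<in> borel_measurable M"
    and mgf: "\<And>b. (\<integral>\<^sup>+\<omega>. ennreal (exp (b \<bullet> X \<omega>)) \<partial>M) = ennreal (exp ((norm b)\<^sup>2 / 2))"
    and l: "0 \<le> l" "2 * l < 1"
    and K: "finite K" "pairwise orthogonal K" "\<And>u. u \<in> K \<Longrightarrow> norm u = 1"
  shows "(\<integral>\<^sup>+\<omega>. ennreal (exp (b \<bullet> X \<omega> + l * (\<Sum>u\<in>K. (X \<omega> \<bullet> u)\<^sup>2))) \<partial>M)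
    = ennreal ((1 / sqrt (1 - 2 * l)) ^ card K * exp ((norm b)\<^sup>2 / 2 + l / (1 - 2 * l) * (\<Sum>u\<in>K. (b \<bullet> u)\<^sup>2)))"
  using K
\<comment> \<open>Linearising the square of a new direction changes the linear term, hence the
  general \<open>b\<close>.\<close>
proof (induction K arbitrary: b rule: finite_induct)
  case empty
  show ?case using mgf by simp
next
  case (insert u K)
  interpret pair_sigma_finite M lborel ..
  define d where "d = sqrt (2 * l)"
  define r where "r = 1 / sqrt (1 - 2 * l)"
  have d2: "d\<^sup>2 = 2 * l" using l by (simp add: d_def)
  have r: "0 \<le> r" using l by (simp add: r_def)
  let ?Q = "\<lambda>\<omega>. \<Sum>u\<in>K. (X \<omega> \<bullet> u)\<^sup>2"
  have o: "pairwise orthogonal K" "\<And>v. v \<in> K \<Longrightarrow> norm v = 1"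
    using insert.prems by (auto simp: pairwise_insert)
  have ou: "u \<bullet> v = 0" if "v \<in> K" for v
    using insert.prems(1) insert.hyps that by (auto simp: pairwise_insert orthogonal_def)
  have nu: "norm u = 1" "u \<bullet> u = 1" using insert.prems(2) by (auto simp: dot_square_norm)
  have lin: "ennreal (exp (l * s\<^sup>2)) = (\<integral>\<^sup>+g. ennreal (std_normal_density g) * ennreal (exp (d * s * g)) \<partial>lborel)" for s
    using nn_integral_normal_exp_quadratic[of 1 0 "d * s"] d2 by (simp add: power_mult_distrib)
  have "(\<integral>\<^sup>+\<omega>. ennreal (exp (b \<bullet> X \<omega> + l * (\<Sum>u\<in>insert u K. (X \<omega> \<bullet> u)\<^sup>2))) \<partial>M)
    = (\<integral>\<^sup>+\<omega>. ennreal (exp (b \<bullet> X \<omega> + l * ?Q \<omega>)) * ennreal (exp (l * (X \<omega> \<bullet> u)\<^sup>2)) \<partial>M)"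
    using insert.hyps by (intro nn_integral_cong) (simp add: ennreal_mult[symmetric] exp_add[symmetric] algebra_simps)
  also have "\<dots> = (\<integral>\<^sup>+\<omega>. \<integral>\<^sup>+g. ennreal (exp (b \<bullet> X \<omega> + l * ?Q \<omega>)) *
      (ennreal (std_normal_density g) * ennreal (exp (d * (X \<omega> \<bullet> u) * g))) \<partial>lborel \<partial>M)"
    unfolding lin by (intro nn_integral_cong nn_integral_cmult[symmetric]) auto
  also have "\<dots> = (\<integral>\<^sup>+g. \<integral>\<^sup>+\<omega>. ennreal (exp (b \<bullet> X \<omega> + l * ?Q \<omega>)) *
      (ennreal (std_normal_density g) * ennreal (exp (d * (X \<omega> \<bullet> u) * g))) \<partial>M \<partial>lborel)"
    by (rule Fubini'[symmetric]) measurable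
  also have "\<dots> = (\<integral>\<^sup>+g. ennreal (r ^ card K * exp ((norm b)\<^sup>2 / 2 + l / (1 - 2 * l) * (\<Sum>u\<in>K. (b \<bullet> u)\<^sup>2))) *
      (ennreal (std_normal_density g) * ennreal (exp (d * (b \<bullet> u) * g + l * g\<^sup>2))) \<partial>lborel)"
  proof (rule nn_integral_cong)
    fix g :: real
    \<comment> \<open>For fixed \<open>g\<close> the linearised factor merely shifts
      \<open>b\<close> along \<open>u\<close>. By orthogonality the inner products with
      \<open>K\<close> stay the same, and the norm contributes the quadratic l g^2 because d^2 = 2
      l.\<close>
    let ?b = "b + (d * g) *\<^sub>R u"
    have nb: "(norm ?b)\<^sup>2 / 2 = (norm b)\<^sup>2 / 2 + (d * (b \<bullet> u) * g + l * g\<^sup>2)"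
      unfolding power2_norm_eq_inner using nu(2) d2
      by (simp add: inner_add_left inner_add_right inner_commute power2_eq_square field_simps)
    have bu: "?b \<bullet> v = b \<bullet> v" if "v \<in> K" for v
      using ou[OF that] by (simp add: inner_add_left)
    have "(\<integral>\<^sup>+\<omega>. ennreal (exp (b \<bullet> X \<omega> + l * ?Q \<omega>)) *
        (ennreal (std_normal_density g) * ennreal (exp (d * (X \<omega> \<bullet> u) * g))) \<partial>M)
      = (\<integral>\<^sup>+\<omega>. ennreal (std_normal_density g) * ennreal (exp (?b \<bullet> X \<omega> + l * ?Q \<omega>)) \<partial>M)"
    proof (rule nn_integral_cong)
      fix \<omega>
      have "exp (?b \<bullet> X \<omega> + l * ?Q \<omega>) = exp (b \<bullet> X \<omega> + l * ?Q \<omega>) * exp (d * (X \<omega> \<bullet> u) * g)"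
        unfolding exp_add[symmetric] by (simp add: inner_add_left inner_commute algebra_simps)
      then show "ennreal (exp (b \<bullet> X \<omega> + l * ?Q \<omega>)) *
        (ennreal (std_normal_density g) * ennreal (exp (d * (X \<omega> \<bullet> u) * g)))
        = ennreal (std_normal_density g) * ennreal (exp (?b \<bullet> X \<omega> + l * ?Q \<omega>))"
        by (simp add: ennreal_mult mult_ac)
    qed
    also have "\<dots> = ennreal (std_normal_density g) * ennreal (r ^ card K *
        exp ((norm ?b)\<^sup>2 / 2 + l / (1 - 2 * l) * (\<Sum>v\<in>K. (?b \<bullet> v)\<^sup>2)))"
      using insert.IH[OF o, of ?b] by (subst nn_integral_cmult) (auto simp: r_def)
    also have "(\<Sum>v\<in>K. (?b \<bullet> v)\<^sup>2) = (\<Sum>v\<in>K. (b \<bullet> v)\<^sup>2)"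
      by (intro sum.cong refl) (simp add: bu)
    also have "exp ((norm ?b)\<^sup>2 / 2 + l / (1 - 2 * l) * (\<Sum>v\<in>K. (b \<bullet> v)\<^sup>2))
      = exp ((norm b)\<^sup>2 / 2 + l / (1 - 2 * l) * (\<Sum>v\<in>K. (b \<bullet> v)\<^sup>2)) * exp (d * (b \<bullet> u) * g + l * g\<^sup>2)"
      unfolding nb exp_add[symmetric] by (simp add: algebra_simps)
    finally show "(\<integral>\<^sup>+\<omega>. ennreal (exp (b \<bullet> X \<omega> + l * ?Q \<omega>)) *
        (ennreal (std_normal_density g) * ennreal (exp (d * (X \<omega> \<bullet> u) * g))) \<partial>M)
      = ennreal (r ^ card K * exp ((norm b)\<^sup>2 / 2 + l / (1 - 2 * l) * (\<Sum>u\<in>K. (b \<bullet> u)\<^sup>2))) *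
      (ennreal (std_normal_density g) * ennreal (exp (d * (b \<bullet> u) * g + l * g\<^sup>2)))"
      using r by (simp add: ennreal_mult mult_ac)
  qed
  also have "\<dots> = ennreal (r ^ card K * exp ((norm b)\<^sup>2 / 2 + l / (1 - 2 * l) * (\<Sum>u\<in>K. (b \<bullet> u)\<^sup>2))) *
      ennreal (r * exp ((d * (b \<bullet> u))\<^sup>2 / (2 * (1 - 2 * l))))"
    using nn_integral_normal_exp_quadratic[of 1 l "d * (b \<bullet> u)"] l
    by (subst nn_integral_cmult) (auto simp: r_def)
  also have "\<dots> = ennreal (r ^ card (insert u K) *
    exp ((norm b)\<^sup>2 / 2 + l / (1 - 2 * l) * (\<Sum>u\<in>insert u K. (b \<bullet> u)\<^sup>2)))"
  proof -
    have cancel: "2 * y / (2 * z) = y / z" for y z :: real by simp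
    have "(d * (b \<bullet> u))\<^sup>2 = 2 * (l * (b \<bullet> u)\<^sup>2)" using d2 by (simp add: power_mult_distrib)
    then have du: "(d * (b \<bullet> u))\<^sup>2 / (2 * (1 - 2 * l)) = l / (1 - 2 * l) * (b \<bullet> u)\<^sup>2"
      by (simp only: cancel times_divide_eq_left)
    have "exp ((norm b)\<^sup>2 / 2 + l / (1 - 2 * l) * (\<Sum>u\<in>insert u K. (b \<bullet> u)\<^sup>2))
      = exp ((norm b)\<^sup>2 / 2 + l / (1 - 2 * l) * (\<Sum>u\<in>K. (b \<bullet> u)\<^sup>2)) * exp ((d * (b \<bullet> u))\<^sup>2 / (2 * (1 - 2 * l)))"
      unfolding exp_add[symmetric] du sum.insert[OF insert.hyps] distrib_left
      by (simp only: add_ac)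
    then show ?thesis using insert.hyps r by (simp add: ennreal_mult[symmetric] mult_ac)
  qed
  finally show ?case unfolding r_def .
qed

section \<open>The noise vector and its projections\<close>

lemma borel_measurable_vec_lambda:
  fixes W :: "'n::finite \<Rightarrow> 'w \<Rightarrow> real"
  assumes "\<And>i. W i \<in> borel_measurable M"
  shows "(\<lambda>\<omega>. \<chi> i. W i \<omega>) \<in> borel_measurable M"
proof (subst borel_measurable_euclidean_space, rule ballI)
  fix b :: "real ^ 'n" assume "b \<in> Basis"
  then obtain i where "b = axis i 1" by (auto simp: Basis_vec_def)
  then show "(\<lambda>\<omega>. (\<chi> i. W i \<omega>) \<bullet> b) \<in> borel_measurable M"
    using assms by (simp add: inner_axis)
qed

context prob_space
begin

context
  fixes W :: "'n::finite \<Rightarrow> 'a \<Rightarrow> real" and \<sigma> :: real and Z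
  assumes sigma: "\<sigma> > 0"
    and indep: "indep_vars (\<lambda>_. borel) W UNIV"
    and normal: "\<And>i. distributed M lborel (W i) (normal_density 0 \<sigma>)"
  defines "Z \<equiv> \<lambda>\<omega>. \<chi> i. W i \<omega>"
begin

lemma noise_measurable: "Z \<in> borel_measurable M"
  unfolding Z_def using distributed_measurable[OF normal]
  by (intro borel_measurable_vec_lambda) simp

lemma noise_inner_distributed:
  assumes "b \<noteq> 0"
  shows "distributed M lborel (\<lambda>\<omega>. b \<bullet> Z \<omega>) (normal_density 0 (norm b * \<sigma>))"
proof -
  \<comment> \<open>Zero coordinates would give degenerate normal variables, which have no density;
    since \<open>b\<close> is nonzero, some coordinate remains.\<close>
  let ?I = "{i. b $ i \<noteq> 0}"
  have ne: "?I \<noteq> {}" using assms by (auto simp: vec_eq_iff)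
  have "distributed M lborel (\<lambda>\<omega>. \<Sum>i\<in>?I. b $ i * W i \<omega>)
    (normal_density (\<Sum>i\<in>?I. 0) (sqrt (\<Sum>i\<in>?I. (\<bar>b $ i\<bar> * \<sigma>)\<^sup>2)))"
  proof (rule sum_indep_normal)
    show "indep_vars (\<lambda>_. borel) (\<lambda>i \<omega>. b $ i * W i \<omega>) ?I"
      by (rule indep_vars_compose2[OF indep_vars_subset[OF indep]]) auto
    show "distributed M lborel (\<lambda>\<omega>. b $ i * W i \<omega>) (normal_density 0 (\<bar>b $ i\<bar> * \<sigma>))" if "i \<in> ?I" for i
      using normal_density_affine[OF normal[of i] sigma, of "b $ i" 0] that by simp
  qed (use ne sigma in auto)
  also have "(\<lambda>\<omega>. \<Sum>i\<in>?I. b $ i * W i \<omega>) = (\<lambda>\<omega>. b \<bullet> Z \<omega>)"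
    unfolding Z_def inner_vec_def by (intro ext sum.mono_neutral_cong_left) auto
  also have "(\<Sum>i\<in>?I. (\<bar>b $ i\<bar> * \<sigma>)\<^sup>2) = (\<Sum>i\<in>UNIV. (b $ i)\<^sup>2 * \<sigma>\<^sup>2)"
    by (intro sum.mono_neutral_cong_left) (auto simp: power_mult_distrib)
  also have "\<dots> = (norm b * \<sigma>)\<^sup>2"
    by (simp add: norm_vec_def L2_set_def power_mult_distrib sum_nonneg sum_distrib_right)
  finally show ?thesis using sigma by simp
qed

lemma noise_inner_integrable: "integrable M (\<lambda>\<omega>. Z \<omega> \<bullet> b)"
  and noise_inner_expectation: "expectation (\<lambda>\<omega>. Z \<omega> \<bullet> b) = 0"
  and noise_inner_sq_integrable: "integrable M (\<lambda>\<omega>. (Z \<omega> \<bullet> b)\<^sup>2)"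
  and noise_inner_sq_expectation: "expectation (\<lambda>\<omega>. (Z \<omega> \<bullet> b)\<^sup>2) = (norm b * \<sigma>)\<^sup>2"
proof -
  have "integrable M (\<lambda>\<omega>. Z \<omega> \<bullet> b) \<and> expectation (\<lambda>\<omega>. Z \<omega> \<bullet> b) = 0 \<and>
    integrable M (\<lambda>\<omega>. (Z \<omega> \<bullet> b)\<^sup>2) \<and> expectation (\<lambda>\<omega>. (Z \<omega> \<bullet> b)\<^sup>2) = (norm b * \<sigma>)\<^sup>2"
  proof (cases "b = 0")
    case False
    let ?t = "norm b * \<sigma>"
    have t: "0 < ?t" using False sigma by simp
    note D = noise_inner_distributed[OF False]
    have m: "expectation (\<lambda>\<omega>. b \<bullet> Z \<omega>) = 0" by (rule normal_distributed_expectation[OF t D])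
    have "integrable M (\<lambda>\<omega>. b \<bullet> Z \<omega>)"
      using distributed_integrable[OF D, of "\<lambda>x. x"] integrable_normal_moment[OF t, of 0 1] by simp
    moreover have "integrable M (\<lambda>\<omega>. (b \<bullet> Z \<omega>)\<^sup>2)"
      using distributed_integrable[OF D, of "\<lambda>x. x\<^sup>2"] integrable_normal_moment[OF t, of 0 2] by simp
    moreover have "expectation (\<lambda>\<omega>. (b \<bullet> Z \<omega>)\<^sup>2) = ?t\<^sup>2"
      using normal_distributed_variance[OF t D] m by simp
    ultimately show ?thesis using m by (simp add: inner_commute)
  qed simp
  then show "integrable M (\<lambda>\<omega>. Z \<omega> \<bullet> b)" "expectation (\<lambda>\<omega>. Z \<omega> \<bullet> b) = 0"
    "integrable M (\<lambda>\<omega>. (Z \<omega> \<bullet> b)\<^sup>2)" "expectation (\<lambda>\<omega>. (Z \<omega> \<bullet> b)\<^sup>2) = (norm b * \<sigma>)\<^sup>2"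
    by auto
qed

lemma noise_mgf:
  "(\<integral>\<^sup>+\<omega>. ennreal (exp (b \<bullet> (Z \<omega> /\<^sub>R \<sigma>))) \<partial>M) = ennreal (exp ((norm b)\<^sup>2 / 2))"
proof (cases "b = 0")
  case True
  then show ?thesis by (simp add: emeasure_space_1)
next
  case False
  let ?b = "b /\<^sub>R \<sigma>"
  have b: "?b \<noteq> 0" "norm ?b * \<sigma> = norm b" using False sigma by auto
  have "(\<integral>\<^sup>+\<omega>. ennreal (exp (b \<bullet> (Z \<omega> /\<^sub>R \<sigma>))) \<partial>M) = (\<integral>\<^sup>+\<omega>. ennreal (exp (?b \<bullet> Z \<omega>)) \<partial>M)"
    by simp
  also have "\<dots> = (\<integral>\<^sup>+x. ennreal (normal_density 0 (norm b) x) * ennreal (exp x) \<partial>lborel)"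
    using noise_inner_distributed[OF b(1)] unfolding b(2)
    by (intro distributed_nn_integral[symmetric]) auto
  also have "\<dots> = ennreal (exp ((norm b)\<^sup>2 / 2))"
    using nn_integral_normal_exp_quadratic[of "norm b" 0 1] False by simp
  finally show ?thesis .
qed

text \<open>The order 3/8 is convenient because 1 - 2 (3/8) = 1/4, so each orthonormal direction
  contributes exactly the factor 2.\<close>

lemma noise_exp_projection:
  assumes "finite K" "pairwise orthogonal K" "\<And>u. u \<in> K \<Longrightarrow> norm u = 1"
  shows "integrable M (\<lambda>\<omega>. exp (3 / 8 * (\<Sum>u\<in>K. ((Z \<omega> /\<^sub>R \<sigma>) \<bullet> u)\<^sup>2)))" (is ?I)
    and "expectation (\<lambda>\<omega>. exp (3 / 8 * (\<Sum>u\<in>K. ((Z \<omega> /\<^sub>R \<sigma>) \<bullet> u)\<^sup>2))) = 2 ^ card K" (is ?E)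
proof -
  note [measurable] = noise_measurable
  have "sqrt (1 - 2 * (3 / 8)) = (1 / 2 :: real)"
    by (rule real_sqrt_unique) (auto simp: power2_eq_square)
  then have r: "1 / sqrt (1 - 2 * (3 / 8)) = (2 :: real)" by (simp only:) simp
  have "(\<integral>\<^sup>+\<omega>. ennreal (exp (3 / 8 * (\<Sum>u\<in>K. ((Z \<omega> /\<^sub>R \<sigma>) \<bullet> u)\<^sup>2))) \<partial>M) = ennreal (2 ^ card K)"
    using nn_integral_gaussian_exp_projection[of "\<lambda>\<omega>. Z \<omega> /\<^sub>R \<sigma>" "3 / 8" K 0, unfolded r] noise_mgf assms
    by simp
  then have "?I \<and> ?E"
    by (subst (asm) nn_integral_eq_integrable) auto
  then show ?I ?E by auto
qed

end

end

subsection \<open>Risk of the penalised estimator\<close>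

lemma norm_vec_sq: "(norm (y :: real ^ 'n::finite))\<^sup>2 = (\<Sum>i\<in>UNIV. (y $ i)\<^sup>2)"
  by (simp add: norm_vec_def L2_set_def sum_nonneg)

lemma vec_comb_design:
  "vec_comb (\<lambda>j. \<chi> i::'n::finite. F j (x i)) lam = (\<chi> i. lin_comb F lam (x i))"
  by (simp add: vec_comb_def lin_comb_def vec_eq_iff sum_component)

lemma emp_norm_sq:
  fixes x :: "'n::finite \<Rightarrow> 'x"
  shows "(emp_norm x g)\<^sup>2 = (norm (\<chi> i. g (x i)))\<^sup>2 / real CARD('n)"
  by (simp add: emp_norm_def norm_vec_sq sum_nonneg)

theorem theorem3p1:
  fixes P :: "'w measure"
    and \<X> :: "(real ^ 'd) set"
    and x :: "'n::finite \<Rightarrow> real ^ 'd"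
    and f :: "real ^ 'd \<Rightarrow> real"
    and F :: "'m::finite \<Rightarrow> real ^ 'd \<Rightarrow> real"
    and W :: "'n \<Rightarrow> 'w \<Rightarrow> real"
    and Y :: "'w \<Rightarrow> real ^ 'n"
    and L \<sigma> a :: real
    and lam_hat :: "real ^ 'n \<Rightarrow> real ^ 'm"
    and f_tilde :: "'w \<Rightarrow> real ^ 'd \<Rightarrow> real"
  assumes "prob_space P"
    and "CARD('m) \<ge> 2"
    and "\<X> \<in> sets borel"
    and "\<And>i. x i \<in> \<X>"
    and "\<And>z. z \<in> \<X> \<Longrightarrow> \<bar>f z\<bar> \<le> L"
    and "\<And>j z. z \<in> \<X> \<Longrightarrow> \<bar>F j z\<bar> \<le> L"
    and "\<sigma> > 0"
    and "a > 0"
    and "prob_space.indep_vars P (\<lambda>_. borel) W UNIV"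
    and "\<And>i. distributed P lborel (W i) (normal_density 0 \<sigma>)"
    and "\<And>\<omega>. \<omega> \<in> space P \<Longrightarrow> Y \<omega> = (\<chi> i. f (x i) + W i \<omega>)"
    and "lam_hat \<in> borel_measurable borel"
    and "\<And>\<omega>. \<omega> \<in> space P \<Longrightarrow>
           is_arg_min (pls_crit F x \<sigma> a (Y \<omega>)) (\<lambda>_. True) (lam_hat (Y \<omega>))"
    and "\<And>\<omega>. \<omega> \<in> space P \<Longrightarrow> f_tilde \<omega> = lin_comb F (lam_hat (Y \<omega>))"
  shows "integrable P (\<lambda>\<omega>. (emp_norm x (\<lambda>z. f_tilde \<omega> z - f z))\<^sup>2) \<and>
    prob_space.expectation P (\<lambda>\<omega>. (emp_norm x (\<lambda>z. f_tilde \<omega> z - f z))\<^sup>2)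
      \<le> (1 + a) * (INF lam::real ^ 'm.
            (emp_norm x (\<lambda>z. lin_comb F lam z - f z))\<^sup>2
            + \<sigma>\<^sup>2 / real CARD('n) * (5 + (2 + 3 * a) / a * log_factor lam) * real (num_nonzero lam))
        + \<sigma>\<^sup>2 / real CARD('n) * (6 * (1 + a)\<^sup>2 / (a * (exp 1 - 1)))"
proof -
  interpret prob_space P by fact
  define n where "n = CARD('n)"
  define V where "V = (\<lambda>j. \<chi> i. F j (x i))"
  define v where "v = (\<chi> i. f (x i))"
  define Z where "Z = (\<lambda>\<omega>. \<chi> i. W i \<omega>)"
  \<comment> \<open>\<open>C\<close>, \<open>G\<close> and \<open>risk\<close> are scaled by the
    sample size; the division is restored at the end.\<close>
  define C where "C = \<sigma>\<^sup>2 * (6 * (1 + a)\<^sup>2 / (a * (exp 1 - 1)))"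
  define G where "G lam = (norm (vec_comb V lam - v))\<^sup>2
    + \<sigma>\<^sup>2 * ((5 + (2 + 3 * a) / a * log_factor lam) * real (num_nonzero lam))" for lam
  define risk where "risk \<omega> = (norm (vec_comb V (lam_hat (Y \<omega>)) - v))\<^sup>2" for \<omega>
  note sigma = \<open>\<sigma> > 0\<close> and a = \<open>a > 0\<close>
  note noise = assms(7,9,10)
  note [measurable] = noise_measurable[OF noise, folded Z_def] \<open>lam_hat \<in> borel_measurable borel\<close>
  have n: "n > 0" by (simp add: n_def)
  have Y: "Y \<omega> = v + Z \<omega>" if "\<omega> \<in> space P" for \<omega>
    using assms(11)[OF that] by (simp add: v_def Z_def vec_eq_iff)
  have emp: "(emp_norm x (\<lambda>z. lin_comb F lam z - f z))\<^sup>2 = (norm (vec_comb V lam - v))\<^sup>2 / real n" for lam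
    unfolding emp_norm_sq n_def V_def v_def vec_comb_design
    by (simp add: norm_vec_sq)
  have crit: "pls_crit F x \<sigma> a y lam = (norm (y - vec_comb V lam))\<^sup>2 / real n + pen n \<sigma> a lam" for y lam
    unfolding pls_crit_def V_def vec_comb_design n_def by (simp add: norm_vec_sq)
  have min: "(norm (v + Z \<omega> - vec_comb V (lam_hat (Y \<omega>))))\<^sup>2 + real n * pen n \<sigma> a (lam_hat (Y \<omega>))
      \<le> (norm (v + Z \<omega> - vec_comb V mu))\<^sup>2 + real n * pen n \<sigma> a mu" if "\<omega> \<in> space P" for \<omega> mu
  proof -
    have "pls_crit F x \<sigma> a (Y \<omega>) (lam_hat (Y \<omega>)) \<le> pls_crit F x \<sigma> a (Y \<omega>) mu"
      using assms(13)[OF that] by (auto simp: is_arg_min_def not_less)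
    from mult_left_mono[OF this, of "real n"] show ?thesis
      using n by (simp add: crit distrib_left Y[OF that])
  qed
  have [measurable]: "(\<lambda>\<omega>. h \<omega> $ j) \<in> borel_measurable P"
    if "h \<in> borel_measurable P" for h :: "'w \<Rightarrow> real ^ 'm" and j
    using borel_measurable_inner[OF that borel_measurable_const[of "axis j 1"]]
    by (simp add: inner_axis)
  have risk_measurable: "risk \<in> borel_measurable P"
  proof -
    \<comment> \<open>\<open>Y\<close> is specified only on the space of \<open>P\<close>, so
      measurability is shown for \<open>v + Z\<close> and transferred.\<close>
    have "(\<lambda>\<omega>. (norm (vec_comb V (lam_hat (v + Z \<omega>)) - v))\<^sup>2) \<in> borel_measurable P"
      unfolding vec_comb_def by measurable
    then show ?thesis
      by (subst measurable_cong[where g = "\<lambda>\<omega>. (norm (vec_comb V (lam_hat (v + Z \<omega>)) - v))\<^sup>2"])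
        (auto simp: risk_def Y)
  qed
  have "\<exists>B. finite B \<and> pairwise orthogonal B \<and> (\<forall>u\<in>B. norm u = 1) \<and>
      span B = span ((\<lambda>j. residual (sgn v) (V j)) ` J) \<and> card B \<le> card J" for J
    using orthonormal_basis_span_image[of "\<lambda>j. residual (sgn v) (V j)" J] by metis
  \<comment> \<open>The bases are chosen before any outcome, so the sum over models is an ordinary
    random variable.\<close>
  then obtain BJ where BJ: "\<And>J. finite (BJ J)" "\<And>J. pairwise orthogonal (BJ J)"
      "\<And>J u. u \<in> BJ J \<Longrightarrow> norm u = 1"
      "\<And>J. span (BJ J) = span ((\<lambda>j. residual (sgn v) (V j)) ` J)" "\<And>J. card (BJ J) \<le> card J"
    by metis
  let ?w = "\<lambda>J. log_weight CARD('m) (card J) * real (card J)"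
  define E where "E \<omega> = (\<Sum>J\<in>{J. J \<noteq> {}}. exp (3 / 8 * (\<Sum>u\<in>BJ J. ((Z \<omega> /\<^sub>R \<sigma>) \<bullet> u)\<^sup>2) - 3 / 4 * ?w J))" for \<omega>
  have E_eq: "E \<omega> = (\<Sum>J\<in>{J. J \<noteq> {}}. exp (3 / 8 * (\<Sum>u\<in>BJ J. ((Z \<omega> /\<^sub>R \<sigma>) \<bullet> u)\<^sup>2)) * exp (- (3 / 4) * ?w J))" for \<omega>
    unfolding E_def by (simp add: exp_add[symmetric])
  have lin: "integrable P (\<lambda>\<omega>. Z \<omega> \<bullet> b)" "expectation (\<lambda>\<omega>. Z \<omega> \<bullet> b) = 0" for b
    unfolding Z_def
    by (rule noise_inner_integrable[OF noise], rule noise_inner_expectation[OF noise])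
  have sq: "integrable P (\<lambda>\<omega>. (Z \<omega> \<bullet> b)\<^sup>2)"
    "expectation (\<lambda>\<omega>. (Z \<omega> \<bullet> b)\<^sup>2) = (norm b * \<sigma>)\<^sup>2" for b
    unfolding Z_def
    by (rule noise_inner_sq_integrable[OF noise], rule noise_inner_sq_expectation[OF noise])
  have gauss: "integrable P (\<lambda>\<omega>. exp (3 / 8 * (\<Sum>u\<in>BJ J. ((Z \<omega> /\<^sub>R \<sigma>) \<bullet> u)\<^sup>2)))"
    "expectation (\<lambda>\<omega>. exp (3 / 8 * (\<Sum>u\<in>BJ J. ((Z \<omega> /\<^sub>R \<sigma>) \<bullet> u)\<^sup>2))) = 2 ^ card (BJ J)" for J
    unfolding Z_def by (rule noise_exp_projection[OF noise]; use BJ in blast)+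
  have E_int: "integrable P E"
    unfolding E_eq by (intro Bochner_Integration.integrable_sum integrable_mult_left gauss(1))
  have "expectation E = (\<Sum>J\<in>{J. J \<noteq> {}}. 2 ^ card (BJ J) * exp (- (3 / 4) * ?w J))"
    unfolding E_eq
    by (subst Bochner_Integration.integral_sum) (simp_all only: gauss integrable_mult_left integral_mult_left_zero)
  also have "\<dots> \<le> (\<Sum>J\<in>{J::'m set. J \<noteq> {}}. 2 ^ card J * exp (- (3 / 4) * ?w J))"
    by (intro sum_mono mult_right_mono power_increasing BJ) auto
  also have "\<dots> \<le> exp (- (1 / 2)) * (2 / (exp 1 - 2))" by (rule sum_subsets_weight_le)
  finally have "8 / (3 * exp 1) * expectation E \<le> 8 / (3 * exp 1) * (exp (- (1 / 2)) * (2 / (exp 1 - 2)))"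
    by (intro mult_left_mono) auto
  with risk_constant_le have E_le: "1 + 8 / (3 * exp 1) * expectation E \<le> 6 / (exp 1 - 1)" by linarith
  have main: "integrable P risk \<and> expectation risk \<le> (1 + a) * G lam + C" for lam
  proof -
    obtain B where B: "finite B" "pairwise orthogonal B" "\<And>u. u \<in> B \<Longrightarrow> norm u = 1"
      "span B = span (V ` supp lam)"
      using orthonormal_basis_span_image[of V "supp lam"] by metis
    define q where "q = v - vec_comb V lam - (\<Sum>u\<in>B. ((v - vec_comb V lam) \<bullet> u) *\<^sub>R u)"
    define U where "U \<omega> = (1 + a) * ((norm (vec_comb V lam - v))\<^sup>2 + 2 * (Z \<omega> \<bullet> q) - (\<Sum>u\<in>B. (Z \<omega> \<bullet> u)\<^sup>2)
     + \<sigma>\<^sup>2 * (real (card B) + (5 + (2 + 3 * a) / a * log_factor lam) * real (num_nonzero lam))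
     + (1 + a) / a * ((Z \<omega> \<bullet> sgn v)\<^sup>2 + \<sigma>\<^sup>2 * (8 / (3 * exp 1) * E \<omega>)))" for \<omega>
    have le: "risk \<omega> \<le> U \<omega>" if "\<omega> \<in> space P" for \<omega>
      unfolding risk_def U_def E_def
      by (rule oracle_inequality_pointwise[OF a sigma n min[OF that] B BJ(1-4) q_def])
    have U_int: "integrable P U"
      unfolding U_def
      by (intro integrable_mult_right Bochner_Integration.integrable_add Bochner_Integration.integrable_diff
          Bochner_Integration.integrable_sum integrable_const lin sq E_int)
    have sumB: "expectation (\<lambda>\<omega>. \<Sum>u\<in>B. (Z \<omega> \<bullet> u)\<^sup>2) = \<sigma>\<^sup>2 * real (card B)"
      by (subst Bochner_Integration.integral_sum) (simp_all add: sq B(3))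
    have sum_int: "integrable P (\<lambda>\<omega>. \<Sum>u\<in>B. (Z \<omega> \<bullet> u)\<^sup>2)"
      by (intro Bochner_Integration.integrable_sum sq)
    \<comment> \<open>The linear term has mean zero, and the mean gain cancels the dimension kept
      aside in \<open>pen_le\<close>.\<close>
    have "expectation U = (1 + a) * ((norm (vec_comb V lam - v))\<^sup>2 - \<sigma>\<^sup>2 * real (card B)
     + \<sigma>\<^sup>2 * (real (card B) + (5 + (2 + 3 * a) / a * log_factor lam) * real (num_nonzero lam))
     + (1 + a) / a * ((norm (sgn v) * \<sigma>)\<^sup>2 + \<sigma>\<^sup>2 * (8 / (3 * exp 1) * expectation E)))"
      unfolding U_def using lin sq E_int sum_int by (simp add: sumB prob_space)
    also have "\<dots> = (1 + a) * (G lam + (1 + a) / a * ((norm (sgn v) * \<sigma>)\<^sup>2 + \<sigma>\<^sup>2 * (8 / (3 * exp 1) * expectation E)))"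
      unfolding G_def by (simp add: algebra_simps)
    also have "\<dots> \<le> (1 + a) * (G lam + (1 + a) / a * (\<sigma>\<^sup>2 * (6 / (exp 1 - 1))))"
    proof -
      \<comment> \<open>An inequality, since \<open>sgn v\<close> is zero when \<open>v\<close>
        is.\<close>
      have "(norm (sgn v) * \<sigma>)\<^sup>2 \<le> \<sigma>\<^sup>2" by (simp add: norm_sgn)
      moreover have "\<sigma>\<^sup>2 * (1 + 8 / (3 * exp 1) * expectation E) \<le> \<sigma>\<^sup>2 * (6 / (exp 1 - 1))"
        using E_le by (intro mult_left_mono) auto
      ultimately have "(norm (sgn v) * \<sigma>)\<^sup>2 + \<sigma>\<^sup>2 * (8 / (3 * exp 1) * expectation E) \<le> \<sigma>\<^sup>2 * (6 / (exp 1 - 1))"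
        by (simp only: distrib_left mult_1_right)
      then show ?thesis using a by (intro mult_left_mono add_left_mono) auto
    qed
    also have "\<dots> = (1 + a) * G lam + C"
    proof -
      have "(1 + a) * ((1 + a) / a * (\<sigma>\<^sup>2 * (6 / (exp 1 - 1)))) = C"
        unfolding C_def by (simp add: power2_eq_square)
      then show ?thesis by (simp only: distrib_left)
    qed
    finally have EU: "expectation U \<le> (1 + a) * G lam + C" .
    have risk_int: "integrable P risk"
    proof (rule Bochner_Integration.integrable_bound[OF U_int risk_measurable])
      show "AE \<omega> in P. norm (risk \<omega>) \<le> norm (U \<omega>)"
      proof (rule AE_I2)
        fix \<omega> assume "\<omega> \<in> space P"
        with le[of \<omega>] show "norm (risk \<omega>) \<le> norm (U \<omega>)"
          by (simp add: risk_def)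
      qed
    qed
    then have "expectation risk \<le> expectation U"
      using U_int le by (intro integral_mono) auto
    with EU risk_int show ?thesis by simp
  qed
  have emp_risk: "(emp_norm x (\<lambda>z. f_tilde \<omega> z - f z))\<^sup>2 = risk \<omega> / real n" if "\<omega> \<in> space P" for \<omega>
    unfolding risk_def assms(14)[OF that] by (rule emp)
  have int: "integrable P (\<lambda>\<omega>. (emp_norm x (\<lambda>z. f_tilde \<omega> z - f z))\<^sup>2)"
    \<comment> \<open>Integrability does not involve the target, so any vector serves.\<close>
    using main[of 0] by (subst Bochner_Integration.integrable_cong[OF refl emp_risk]) auto
  have exp: "expectation (\<lambda>\<omega>. (emp_norm x (\<lambda>z. f_tilde \<omega> z - f z))\<^sup>2) = expectation risk / real n"
    by (subst Bochner_Integration.integral_cong[OF refl emp_risk]) auto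
  have G: "(emp_norm x (\<lambda>z. lin_comb F lam z - f z))\<^sup>2
            + \<sigma>\<^sup>2 / real n * (5 + (2 + 3 * a) / a * log_factor lam) * real (num_nonzero lam)
      = G lam / real n" for lam
    unfolding emp G_def n_def[symmetric] by (simp add: add_divide_distrib)
  \<comment> \<open>Solving for the target-dependent term gives one lower bound valid for all
    targets, hence for the infimum.\<close>
  have "(expectation risk - C) / (1 + a) / real n \<le> (INF lam. G lam / real n)"
  proof (rule cINF_greatest)
    fix lam
    have "(expectation risk - C) / (1 + a) \<le> G lam"
      using main[of lam] a by (subst pos_divide_le_eq) (auto simp: mult.commute)
    then show "(expectation risk - C) / (1 + a) / real n \<le> G lam / real n"
      by (intro divide_right_mono) auto
  qed simp
  then have "(1 + a) * ((expectation risk - C) / (1 + a) / real n) \<le> (1 + a) * (INF lam. G lam / real n)"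
    using a by (intro mult_left_mono) auto
  moreover have "(1 + a) * ((expectation risk - C) / (1 + a) / real n) = expectation risk / real n - C / real n"
  proof -
    have "1 + a \<noteq> 0" using a by simp
    then have "(1 + a) * ((expectation risk - C) / (1 + a) / real n) = (expectation risk - C) / real n"
      by simp
    then show ?thesis by (simp only: diff_divide_distrib)
  qed
  moreover have "\<sigma>\<^sup>2 / real n * (6 * (1 + a)\<^sup>2 / (a * (exp 1 - 1))) = C / real n"
    by (simp add: C_def)
  ultimately show ?thesis
    using int unfolding exp n_def[symmetric] G by simp
qed

end
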